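(* Let $T_1,T_2,T_3,T_4\in\mathcal{B}_A(\mathcal{H})$ and $T=\begin{bmatrix}T_1&T_2\\ T_3&T_4\end{bmatrix}$. Then $$\max\{w_A^{1/2}(T_2T_3),\,w_A^{1/2}(T_3T_2)\}\le w_{\mathbb{A}}\left(\begin{bmatrix}O&T_2\\ T_3&O\end{bmatrix}\right)\le\frac{1}{2}\left(\|T\|_{\mathbb{A}}+\|T^2\|_{\mathbb{A}}^{1/2}\right).$$
   Context: $\mathcal{H}$ is a complex Hilbert space with inner product $\langle\cdot,\cdot\rangle$, $\mathcal{B}(\mathcal{H})$ is the algebra of bounded linear operators on $\mathcal{H}$, and $A\in\mathcal{B}(\mathcal{H})$ is a positive operator, i.e. $A$ is selfadjoint and $\langle Ax,x\rangle\ge 0$ for all $x$. Put $\langle x,y\rangle_A=\langle Ax,y\rangle$ and $\|x\|_A=\sqrt{\langle x,x\rangle_A}$. $\mathcal{R}(\cdot)$ denotes range, and $\mathcal{B}_A(\mathcal{H})=\{T\in\mathcal{B}(\mathcal{H}):\mathcal{R}(T^*A)\subseteq\mathcal{R}(A)\}$ (the operators admitting an $A$-adjoint, i.e. some $X\in\mathcal{B}(\mathcal{H})$ with $AX=T^*A$). For $T\in\mathcal{B}_A(\mathcal{H})$: the $A$-operator seminorm is $\|T\|_A=\sup\{\|Tx\|_A/\|x\|_A: x\in\overline{\mathcal{R}(A)},\ x\ne 0\}$, and the $A$-numerical radius is $w_A(T)=\sup\{|\langle Tx,x\rangle_A|:x\in\mathcal{H},\ \|x\|_A=1\}$; $w_A^{1/2}(T)$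 means $(w_A(T))^{1/2}$. $\mathbb{A}=\mathrm{diag}(A,A)$ is the positive operator on $\mathcal{H}\oplus\mathcal{H}$ with diagonal entries $A$, and $\|\cdot\|_{\mathbb{A}}$, $w_{\mathbb{A}}$ are defined in the same way with $\mathcal{H}\oplus\mathcal{H}$ and $\mathbb{A}$ in place of $\mathcal{H}$ and $A$. $O$ is the null operator on $\mathcal{H}$. *)

theory Defs
  imports "HOL-Analysis.Analysis"
begin

text \<open>
  Complex Hilbert spaces are built on top of the library's real ones: \<open>real_inner\<close> supplies the
  norm and topology, and the complex structure is tied to it by \<open>scaleR_scaleC\<close> and
  \<open>inner_eq_Re_cinner\<close>.  In particular \<open>norm x = sqrt (Re (cinner x x))\<close>, and definiteness of the
  complex inner product is inherited from \<open>real_inner\<close>.  The inner product is linear in its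
  first argument.
\<close>

class scaleC =
  fixes scaleC :: "complex \<Rightarrow> 'a \<Rightarrow> 'a"  (infixr \<open>*\<^sub>C\<close> 75)

class complex_inner = real_inner + scaleC +
  fixes cinner :: "'a \<Rightarrow> 'a \<Rightarrow> complex"
  assumes scaleC_add_right: "c *\<^sub>C (x + y) = c *\<^sub>C x + c *\<^sub>C y"
    and scaleC_add_left: "(c + d) *\<^sub>C x = c *\<^sub>C x + d *\<^sub>C x"
    and scaleC_scaleC: "c *\<^sub>C (d *\<^sub>C x) = (c * d) *\<^sub>C x"
    and scaleR_scaleC: "r *\<^sub>R x = complex_of_real r *\<^sub>C x"
    and cinner_commute: "cinner x y = cnj (cinner y x)"
    and cinner_add_left: "cinner (x + y) z = cinner x z + cinner y z"
    and cinner_scaleC_left: "cinner (c *\<^sub>C x) y = c * cinner x y"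
    and inner_eq_Re_cinner: "inner x y = Re (cinner x y)"

class complex_hilbert = complex_inner + complete_space

instantiation complex :: complex_hilbert
begin

definition scaleC_complex :: "complex \<Rightarrow> complex \<Rightarrow> complex"
  where "scaleC_complex c x = c * x"

definition cinner_complex :: "complex \<Rightarrow> complex \<Rightarrow> complex"
  where "cinner_complex x y = x * cnj y"

instance
  by standard
    (auto simp: scaleC_complex_def cinner_complex_def algebra_simps inner_complex_def
      scaleR_conv_of_real)

end

text \<open>The Hilbert space direct sum; the library's norm on pairs is already the \<open>\<ell>\<^sup>2\<close> one.\<close>

instantiation prod :: (complex_inner, complex_inner) complex_inner
begin

definition scaleC_prod :: "complex \<Rightarrow> 'a \<times> 'b \<Rightarrow> 'a \<times> 'b"
  where "scaleC_prod c p = (c *\<^sub>C fst p, c *\<^sub>C snd p)"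

definition cinner_prod :: "'a \<times> 'b \<Rightarrow> 'a \<times> 'b \<Rightarrow> complex"
  where "cinner_prod p q = cinner (fst p) (fst q) + cinner (snd p) (snd q)"

instance
proof
  fix c d :: complex and r :: real and x y z :: "'a \<times> 'b"
  show "c *\<^sub>C (x + y) = c *\<^sub>C x + c *\<^sub>C y"
    by (simp add: scaleC_prod_def scaleC_add_right)
  show "(c + d) *\<^sub>C x = c *\<^sub>C x + d *\<^sub>C x"
    by (simp add: scaleC_prod_def scaleC_add_left)
  show "c *\<^sub>C (d *\<^sub>C x) = (c * d) *\<^sub>C x"
    by (simp add: scaleC_prod_def scaleC_scaleC)
  show "r *\<^sub>R x = complex_of_real r *\<^sub>C x"
    by (simp add: scaleC_prod_def scaleR_prod_def scaleR_scaleC)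
  show "cinner x y = cnj (cinner y x)"
    by (simp add: cinner_prod_def cinner_commute[of "fst x"] cinner_commute[of "snd x"])
  show "cinner (x + y) z = cinner x z + cinner y z"
    by (simp add: cinner_prod_def cinner_add_left)
  show "cinner (c *\<^sub>C x) y = c * cinner x y"
    by (simp add: cinner_prod_def scaleC_prod_def cinner_scaleC_left distrib_left)
  show "inner x y = Re (cinner x y)"
    by (simp add: cinner_prod_def inner_prod_def inner_eq_Re_cinner)
qed

end

instance prod :: (complex_hilbert, complex_hilbert) complex_hilbert ..

definition bounded_clinear :: "('a::complex_inner \<Rightarrow> 'b::complex_inner) \<Rightarrow> bool"
  where "bounded_clinear T \<longleftrightarrow> bounded_linear T \<and> (\<forall>c x. T (c *\<^sub>C x) = c *\<^sub>C T x)"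

text \<open>
  For bounded \<open>T\<close> on a Hilbert space exactly one such \<open>S\<close> exists (Riesz), and it is automatically
  bounded and linear.
\<close>

definition cadjoint :: "('a::complex_hilbert \<Rightarrow> 'a) \<Rightarrow> 'a \<Rightarrow> 'a"
  where "cadjoint T = (THE S. \<forall>x y. cinner (T x) y = cinner x (S y))"

lemma cadjoint_eqI:
  assumes "\<And>x y. cinner (T x) y = cinner x (S y)"
  shows "cadjoint T = S"
  unfolding cadjoint_def
proof (rule the_equality)
  show "\<forall>x y. cinner (T x) y = cinner x (S y)"
    using assms by blast
next
  fix S' assume S': "\<forall>x y. cinner (T x) y = cinner x (S' y)"
  show "S' = S"
  proof
    fix y
    have "inner x (S' y) = inner x (S y)" for x
      using S' assms by (simp add: inner_eq_Re_cinner)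
    then have "inner (S' y - S y) (S' y - S y) = 0"
      by (simp add: inner_diff_right)
    then show "S' y = S y"
      by simp
  qed
qed

definition positive_op :: "('a::complex_hilbert \<Rightarrow> 'a) \<Rightarrow> bool"
  where "positive_op A \<longleftrightarrow>
    bounded_clinear A \<and> cadjoint A = A \<and> (\<forall>x. cinner (A x) x \<in> \<real>\<^sub>\<ge>\<^sub>0)"

definition A_inner :: "('a::complex_hilbert \<Rightarrow> 'a) \<Rightarrow> 'a \<Rightarrow> 'a \<Rightarrow> complex"
  where "A_inner A x y = cinner (A x) y"

definition A_norm :: "('a::complex_hilbert \<Rightarrow> 'a) \<Rightarrow> 'a \<Rightarrow> real"
  where "A_norm A x = sqrt (Re (A_inner A x x))"

definition A_adjointable :: "('a::complex_hilbert \<Rightarrow> 'a) \<Rightarrow> ('a \<Rightarrow> 'a) set"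
  where "A_adjointable A = {T. bounded_clinear T \<and> range (cadjoint T \<circ> A) \<subseteq> range A}"

text \<open>
  The two suprema below are of sets of nonnegative reals that are bounded above when \<open>T\<close> belongs to
  \<open>A_adjointable A\<close>.  They are empty when \<open>A = 0\<close>; inserting \<open>0\<close> makes the supremum \<open>0\<close> in that
  case and changes nothing otherwise.
\<close>

definition A_opnorm :: "('a::complex_hilbert \<Rightarrow> 'a) \<Rightarrow> ('a \<Rightarrow> 'a) \<Rightarrow> real"
  where "A_opnorm A T =
    Sup (insert 0 {A_norm A (T x) / A_norm A x |x. x \<in> closure (range A) \<and> x \<noteq> 0})"

definition A_numrad :: "('a::complex_hilbert \<Rightarrow> 'a) \<Rightarrow> ('a \<Rightarrow> 'a) \<Rightarrow> real"
  where "A_numrad A T = Sup (insert 0 {cmod (A_inner A (T x) x) |x. A_norm A x = 1})"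

definition block_op ::
    "('a \<Rightarrow> 'a) \<Rightarrow> ('a \<Rightarrow> 'a) \<Rightarrow> ('a \<Rightarrow> 'a) \<Rightarrow> ('a \<Rightarrow> 'a) \<Rightarrow> 'a \<times> 'a \<Rightarrow> 'a::complex_hilbert \<times> 'a"
  where "block_op T1 T2 T3 T4 = (\<lambda>(x, y). (T1 x + T2 y, T3 x + T4 y))"

definition diag_op :: "('a \<Rightarrow> 'a) \<Rightarrow> 'a \<times> 'a \<Rightarrow> 'a::complex_hilbert \<times> 'a"
  where "diag_op A = block_op A (\<lambda>_. 0) (\<lambda>_. 0) A"

end

theory Submission
  imports Defs
begin

text \<open>
  Write \<open>\<langle>x, y\<rangle>\<close> for the semi-inner product \<open>A_inner A x y\<close> and \<open>\<lparr>x\<rparr>\<close> for its seminorm.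

  The lower bound tests the off-diagonal matrix on vectors \<open>(x, y)\<close> with \<open>y\<close> a multiple of \<open>T3 x\<close>.
  Its quadratic form is \<open>\<langle>T2 y, x\<rangle> + \<langle>T3 x, y\<rangle>\<close>; for \<open>y = t v T3 x\<close> with \<open>t > 0\<close> and \<open>v\<close> a suitable unit
  scalar, both summands have the same argument and the modulus is \<open>t (\<bar>\<langle>T2 T3 x, x\<rangle>\<bar> + \<lparr>T3 x\<rparr>\<^sup>2)\<close>. The
  choice \<open>t = 1 / w\<close>, \<open>w > 0\<close> being the numerical radius of the matrix, makes the terms with
  \<open>\<lparr>T3 x\<rparr>\<^sup>2\<close> cancel (\<open>product_form_le\<close>).

  For the upper bound, the form of the off-diagonal part at \<open>(x, y)\<close> is half the difference of the
  forms of \<open>T\<close> at \<open>(x, y)\<close> and \<open>(x, - y)\<close>, so its numerical radius is at most that of \<open>T\<close>. The rest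
  is Kittaneh's inequality for one operator (\<open>numerical_range_le\<close>). Let \<open>X\<close> be an adjoint of \<open>T\<close> for
  the form, \<open>N\<close> and \<open>M\<close> the seminorms of \<open>T\<close> and \<open>T\<^sup>2\<close>. The quantity \<open>s = \<lparr>X x\<rparr>\<^sup>2 + \<lparr>T x\<rparr>\<^sup>2\<close> equals
  \<open>\<langle>T X x + X T x, x\<rangle>\<close>; expanding \<open>\<lparr>T X x + X T x\<rparr>\<^sup>2\<close> and moving \<open>X\<close> across in the cross term gives
  \<open>s \<le> (N\<^sup>2 + M) \<lparr>x\<rparr>\<^sup>2\<close>. Then \<open>2 Re \<langle>T x, x\<rangle> = Re \<langle>T x + X x, x\<rangle>\<close> and
  \<open>\<lparr>T x + X x\<rparr>\<^sup>2 = s + 2 Re \<langle>T\<^sup>2 x, x\<rangle> \<le> (N\<^sup>2 + 3 M) \<lparr>x\<rparr>\<^sup>2\<close>, and \<open>N\<^sup>2 + 3 M \<le> (N + \<surd>M)\<^sup>2\<close> because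
  \<open>M \<le> N\<^sup>2\<close>.

  The seminorm bounds behind these computations need two facts about \<open>A\<close>. First, the suprema
  defining the seminorm and the numerical radius are finite (\<open>adjoint_imp_semi_bounded\<close>). If \<open>X\<close> is
  an adjoint of \<open>T\<close>, the operator \<open>Q = A X T\<close> has the form \<open>\<langle>T x, T y\<rangle>\<close>. Uniform boundedness gives
  \<open>\<parallel>Q x\<parallel> \<le> C \<parallel>A x\<parallel>\<close>, and between positive operators this implies \<open>Q \<le> C A\<close>
  (\<open>norm_domination_imp_form_domination\<close>), which says \<open>\<lparr>T x\<rparr>\<^sup>2 \<le> C \<lparr>x\<rparr>\<^sup>2\<close>. Secondly, the operator
  seminorm is a supremum over the closure of the range of \<open>A\<close> only, but it bounds \<open>T\<close> everywhere,
  because that range is dense for the seminorm (\<open>approximation_by_range\<close>).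
\<close>

section \<open>Real Hilbert space tools\<close>

lemma linear_coefficient_zero:
  fixes q r :: real
  assumes "\<And>t. 0 \<le> 2 * t * r + t\<^sup>2 * q"
  shows "r = 0"
proof -
  define Q where "Q = \<bar>q\<bar> + 1"
  have Q: "Q > 0" "q - 2 * Q < 0"
    by (auto simp: Q_def)
  have "0 \<le> 2 * (- r / Q) * r + (- r / Q)\<^sup>2 * q"
    using assms .
  also have "\<dots> = r\<^sup>2 * (q - 2 * Q) / Q\<^sup>2"
    using Q by (simp add: field_simps power2_eq_square)
  finally have "0 \<le> r\<^sup>2 * (q - 2 * Q)"
    using Q by (simp add: zero_le_divide_iff)
  with Q show ?thesis
    by (simp add: zero_le_mult_iff)
qed

text \<open>
  The functional \<open>J y = \<parallel>y\<parallel>\<^sup>2 - 2 f y\<close> is bounded below. By the parallelogram identity its minimising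
  sequences are Cauchy, and the vanishing of its derivative at the minimiser is the representation.
\<close>
theorem riesz_representation:
  fixes f :: "'a::{real_inner,complete_space} \<Rightarrow> real"
  assumes "bounded_linear f"
  obtains y where "\<And>x. f x = inner x y"
proof -
  interpret f: bounded_linear f by fact
  define J where "J y = inner y y - 2 * f y" for y
  obtain K where K: "\<And>x. norm (f x) \<le> norm x * K"
    using f.bounded by blast
  have "- K\<^sup>2 \<le> J y" for y
  proof -
    have "0 \<le> (norm y - K)\<^sup>2" by simp
    also have "\<dots> = (norm y)\<^sup>2 - 2 * (norm y * K) + K\<^sup>2"
      by (simp add: power2_diff)
    finally show ?thesis
      using K[of y] by (simp add: J_def power2_norm_eq_inner abs_le_iff)
  qed
  then have bdd: "bdd_below (range J)"
    by (auto intro!: bdd_belowI)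
  define d where "d = Inf (range J)"
  have d_le: "d \<le> J y" for y
    unfolding d_def using bdd by (simp add: cInf_lower)
  have "\<exists>y. J y < d + 1 / real (Suc n)" for n
    using cInf_lessD[of "range J" "d + 1 / real (Suc n)"] by (auto simp: d_def)
  then obtain y where y: "\<And>n. J (y n) < d + 1 / real (Suc n)"
    by metis
  have dist_sq: "(dist (y m) (y n))\<^sup>2 \<le> 2 / real (Suc m) + 2 / real (Suc n)" for m n
  proof -
    have "(dist (y m) (y n))\<^sup>2 = 2 * J (y m) + 2 * J (y n) - 4 * J ((1 / 2) *\<^sub>R (y m + y n))"
      by (simp add: J_def dist_norm power2_norm_eq_inner f.add f.scaleR
          inner_commute algebra_simps)
    moreover have "2 / real (Suc k) = 2 * (1 / real (Suc k))" for k
      by simp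
    ultimately show ?thesis
      using y[of m] y[of n] d_le[of "(1 / 2) *\<^sub>R (y m + y n)"] by argo
  qed
  have "Cauchy y"
  proof (rule metric_CauchyI)
    fix e :: real assume e: "0 < e"
    obtain N where N: "4 / e\<^sup>2 < real N"
      using reals_Archimedean2 by blast
    have "dist (y m) (y n) < e" if "N \<le> m" "N \<le> n" for m n
    proof -
      have N0: "0 < real N"
        using N e by (smt (verit) divide_nonneg_nonneg zero_le_power2)
      have "2 / real (Suc m) \<le> 2 / real N" "2 / real (Suc n) \<le> 2 / real N"
        using that N0 by (auto intro!: divide_left_mono)
      then have "(dist (y m) (y n))\<^sup>2 \<le> 4 / real N"
        using dist_sq[of m n] by linarith
      also have "\<dots> < e\<^sup>2"
        using N N0 e by (simp add: field_simps)
      finally show ?thesis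
        by (rule power2_less_imp_less) (use e in simp)
    qed
    then show "\<exists>M. \<forall>m\<ge>M. \<forall>n\<ge>M. dist (y m) (y n) < e"
      by blast
  qed
  then obtain l where l: "y \<longlonglongrightarrow> l"
    by (auto simp: Cauchy_convergent_iff convergent_def)
  have "(\<lambda>n. J (y n)) \<longlonglongrightarrow> J l"
    unfolding J_def by (intro tendsto_intros f.tendsto l)
  moreover have "(\<lambda>n. d + 1 / real (Suc n)) \<longlonglongrightarrow> d + 0"
    by (intro tendsto_intros LIMSEQ_Suc lim_1_over_n)
  ultimately have "J l \<le> d"
    using LIMSEQ_le[of "\<lambda>n. J (y n)" "J l" "\<lambda>n. d + 1 / real (Suc n)" "d + 0"] y
    by (auto intro: less_imp_le)
  then have min: "J l \<le> J z" for z
    using d_le[of z] by linarith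
  have "f v = inner v l" for v
  proof -
    have "0 \<le> 2 * t * (inner v l - f v) + t\<^sup>2 * inner v v" for t
      using min[of "l + t *\<^sub>R v"]
      by (simp add: J_def f.add f.scaleR inner_commute algebra_simps power2_eq_square)
    then show ?thesis
      using linear_coefficient_zero by fastforce
  qed
  then show thesis
    using that by blast
qed

text \<open>
  The uniform boundedness principle for the functionals \<open>inner v\<close>: by Baire's theorem one of the
  closed sets on which they are all bounded by \<open>n\<close> contains a ball.
\<close>
theorem weakly_bounded_imp_bounded:
  fixes F :: "'a::{real_inner,complete_space} set"
  assumes weak: "\<And>y. \<exists>c. \<forall>v\<in>F. \<bar>inner v y\<bar> \<le> c"
  obtains C where "\<And>v. v \<in> F \<Longrightarrow> norm v \<le> C"
proof -
  define B where "B n = {y. \<forall>v\<in>F. \<bar>inner v y\<bar> \<le> real n}" for n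
  have closed: "closed (B n)" for n
  proof -
    have "B n = (\<Inter>v\<in>F. {y. \<bar>inner v y\<bar> \<le> real n})"
      by (auto simp: B_def)
    then show ?thesis
      by (simp only:) (intro closed_INT ballI closed_Collect_le continuous_intros)
  qed
  have cover: "(\<Union>n. B n) = UNIV"
  proof -
    have "\<exists>n. y \<in> B n" for y
    proof -
      obtain c where c: "\<forall>v\<in>F. \<bar>inner v y\<bar> \<le> c"
        using weak by blast
      obtain n where n: "c \<le> real n"
        using real_arch_simple by blast
      show ?thesis
        using c order_trans[OF _ n] unfolding B_def by blast
    qed
    then show ?thesis by auto
  qed
  have "\<exists>n. interior (B n) \<noteq> {}"
  proof (rule ccontr)
    assume "\<not> ?thesis"
    then have "euclidean interior_of \<Union>(range B) = {}"
      by (intro Baire_category_alt)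
        (auto simp: completely_metrizable_space_euclidean closed)
    with cover show False by simp
  qed
  then obtain n y where "y \<in> interior (B n)" by auto
  then obtain e where e: "e > 0" "ball y e \<subseteq> B n"
    by (meson mem_interior)
  have "norm v \<le> 4 * real n / e" if v: "v \<in> F" for v
  proof (cases "v = 0")
    case False
    define z where "z = y + (e / 2 / norm v) *\<^sub>R v"
    have "z \<in> ball y e" "y \<in> ball y e"
      using e False by (auto simp: z_def dist_norm)
    then have "z \<in> B n" "y \<in> B n"
      using e by blast+
    then have "\<bar>inner v z\<bar> \<le> real n" "\<bar>inner v y\<bar> \<le> real n"
      using v by (auto simp: B_def)
    moreover have "inner v z = inner v y + e / 2 * norm v"
      using False by (simp add: z_def inner_add_right power2_norm_eq_inner[symmetric]
          power2_eq_square)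
    ultimately have "e / 2 * norm v \<le> 2 * real n" by linarith
    then show ?thesis
      using e by (simp add: field_simps)
  qed (use e in simp)
  then show thesis
    using that by blast
qed

section \<open>Order between positive operators\<close>

locale real_positive =
  fixes P :: "'a::real_inner \<Rightarrow> 'a"
  assumes linear: "linear P"
    and sym: "inner (P x) y = inner x (P y)"
    and nonneg: "0 \<le> inner (P x) x"
begin

lemma cauchy_schwarz: "(inner (P x) y)\<^sup>2 \<le> inner (P x) x * inner (P y) y"
proof -
  interpret linear P by (rule linear)
  define p q r where "p = inner (P x) x" and "q = inner (P y) y" and "r = inner (P x) y"
  have ge: "0 \<le> p + 2 * t * r + t\<^sup>2 * q" for t
  proof -
    have "inner (P y) x = r"
      using sym[of y x] by (simp add: r_def inner_commute)
    then show ?thesis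
      using nonneg[of "x + t *\<^sub>R y"]
      by (simp add: add scale p_def q_def r_def inner_add_left inner_add_right power2_eq_square
          algebra_simps)
  qed
  show ?thesis
  proof (cases "q = 0")
    case True
    have "r = 0"
    proof (rule ccontr)
      assume "r \<noteq> 0"
      then show False
        using ge[of "- (p + 1) / (2 * r)"] True by (simp add: field_simps)
    qed
    then show ?thesis
      using True by (simp add: q_def r_def)
  next
    case False
    then have q: "q > 0"
      using nonneg[of y] by (simp add: q_def)
    have "0 \<le> (p + 2 * (- r / q) * r + (- r / q)\<^sup>2 * q) * q"
      using ge[of "- r / q"] q by simp
    also have "\<dots> = p * q - r\<^sup>2"
      using q by (simp add: field_simps power2_eq_square)
    finally show ?thesis
      by (simp add: p_def q_def r_def)
  qed
qed

text \<open>Cauchy--Schwarz for the form of \<open>P\<close>, applied to the pair \<open>x\<close>, \<open>P x\<close>.\<close>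
lemma norm_sq_le:
  assumes "0 \<le> K" and K: "\<And>y. norm (P y) \<le> K * norm y"
  shows "(norm (P x))\<^sup>2 \<le> K * inner (P x) x"
proof (cases "P x = 0")
  case False
  have "(norm (P x))\<^sup>2 * (norm (P x))\<^sup>2 = (inner (P x) (P x))\<^sup>2"
    by (simp add: power2_norm_eq_inner[symmetric] power2_eq_square)
  also have "\<dots> \<le> inner (P x) x * inner (P (P x)) (P x)"
    by (rule cauchy_schwarz)
  also have "inner (P (P x)) (P x) \<le> K * norm (P x) * norm (P x)"
    using norm_cauchy_schwarz[of "P (P x)" "P x"] K[of "P x"]
    by (smt (verit) mult_right_mono norm_ge_zero)
  then have "inner (P x) x * inner (P (P x)) (P x) \<le> inner (P x) x * (K * norm (P x) * norm (P x))"
    using nonneg by (rule mult_left_mono)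
  also have "\<dots> = (K * inner (P x) x) * (norm (P x))\<^sup>2"
    by (simp add: power2_eq_square)
  finally show ?thesis
    using False by (subst (asm) mult_le_cancel_right) auto
qed (use assms nonneg in simp)

text \<open>
  Gradient descent: the residual \<open>r = x - P z\<close> is replaced by \<open>r - P r / K\<close>, again of this shape. Each
  step lowers \<open>\<parallel>r\<parallel>\<^sup>2\<close> by at least \<open>inner (P r) r / K\<close>, and a nonnegative number cannot be lowered by
  \<open>e / K\<close> for ever.
\<close>
lemma approximation_by_range:
  assumes "bounded_linear P" and "0 < e"
  obtains z where "inner (P (x - P z)) (x - P z) < e"
proof -
  interpret bounded_linear P by fact
  obtain K where K: "0 < K" "\<And>y. norm (P y) \<le> norm y * K"
    using pos_bounded by blast
  have step: "(norm (r - (1 / K) *\<^sub>R P r))\<^sup>2 \<le> (norm r)\<^sup>2 - inner (P r) r / K" for r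
  proof -
    have "(norm (P r))\<^sup>2 \<le> K * inner (P r) r"
      using K by (intro norm_sq_le) (auto simp: mult.commute)
    then have "inner (P r) (P r) / K\<^sup>2 \<le> inner (P r) r / K"
      using K unfolding power2_norm_eq_inner by (simp add: field_simps power2_eq_square)
    then show ?thesis
      unfolding power2_norm_eq_inner
      by (simp add: inner_diff_left inner_diff_right inner_commute power2_eq_square)
  qed
  have "\<exists>z. inner (P (x - P z)) (x - P z) < e
          \<or> (norm (x - P z))\<^sup>2 \<le> (norm x)\<^sup>2 - real n * e / K" for n
  proof (induction n)
    case 0
    have "(norm (x - P 0))\<^sup>2 \<le> (norm x)\<^sup>2 - real 0 * e / K"
      by (simp add: zero)
    then show ?case by blast
  next
    case (Suc n)
    then obtain z where z: "inner (P (x - P z)) (x - P z) < e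
        \<or> (norm (x - P z))\<^sup>2 \<le> (norm x)\<^sup>2 - real n * e / K" by blast
    show ?case
    proof (cases "inner (P (x - P z)) (x - P z) < e")
      case True
      then show ?thesis by blast
    next
      case False
      define r where "r = x - P z"
      have eq: "x - P (z + (1 / K) *\<^sub>R r) = r - (1 / K) *\<^sub>R P r"
        by (simp add: add scaleR r_def)
      have "e / K \<le> inner (P r) r / K"
        using False K by (simp add: r_def divide_right_mono)
      moreover have "(norm r)\<^sup>2 \<le> (norm x)\<^sup>2 - real n * e / K"
        using z False by (simp add: r_def)
      ultimately have "(norm (r - (1 / K) *\<^sub>R P r))\<^sup>2 \<le> (norm x)\<^sup>2 - real n * e / K - e / K"
        using step[of r] by linarith
      also have "\<dots> = (norm x)\<^sup>2 - real (Suc n) * e / K"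
        by (simp add: add_divide_distrib distrib_right)
      finally show ?thesis
        unfolding eq[symmetric] by blast
    qed
  qed
  moreover obtain n where n: "(norm x)\<^sup>2 * K / e < real n"
    using reals_Archimedean2 by blast
  moreover have "(norm x)\<^sup>2 < real n * e / K"
    using n K \<open>0 < e\<close> by (simp add: field_simps)
  ultimately show thesis
    using that by (smt (verit) zero_le_power2)
qed

end

text \<open>
  An instance of the operator monotonicity of the square root. If the conclusion failed, the top \<open>l\<close> of
  the numerical range of \<open>D = Q - c A\<close> would be positive. A unit vector \<open>u\<close> at which \<open>D\<close> almost attains \<open>l\<close> is an approximate
  eigenvector, because \<open>l - D\<close> is positive. Hence \<open>Q u\<close> is close to \<open>c A u + l u\<close>, whose squared
  norm exceeds \<open>\<parallel>c A u\<parallel>\<^sup>2\<close> by at least \<open>l\<^sup>2\<close> because \<open>A\<close> is positive; this contradicts the domination.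
\<close>
theorem norm_domination_imp_form_domination:
  fixes A Q :: "'a::real_inner \<Rightarrow> 'a"
  assumes A: "bounded_linear A" and Q: "bounded_linear Q"
    and A_sym: "\<And>x y. inner (A x) y = inner x (A y)"
    and Q_sym: "\<And>x y. inner (Q x) y = inner x (Q y)"
    and A_nonneg: "\<And>x. 0 \<le> inner (A x) x"
    and c: "0 \<le> c" and dom: "\<And>x. norm (Q x) \<le> c * norm (A x)"
  shows "inner (Q x) x \<le> c * inner (A x) x"
proof (rule ccontr)
  assume not_le: "\<not> ?thesis"
  interpret A: bounded_linear A by fact
  interpret Q: bounded_linear Q by fact
  define D where "D x = Q x - c *\<^sub>R A x" for x
  have "bounded_linear D"
    unfolding D_def
    by (intro bounded_linear_sub Q bounded_linear_const_scaleR A)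
  then interpret D: bounded_linear D .
  obtain KD where KD: "0 < KD" "\<And>y. norm (D y) \<le> norm y * KD"
    using D.pos_bounded by blast
  obtain KA where KA: "0 < KA" "\<And>y. norm (A y) \<le> norm y * KA"
    using A.pos_bounded by blast
  define V where "V = {inner (D u) u |u. norm u = 1}"
  define l where "l = Sup V"
  have bdd: "bdd_above V"
  proof (rule bdd_aboveI)
    fix v assume "v \<in> V"
    then obtain u where u: "norm u = 1" "v = inner (D u) u"
      by (auto simp: V_def)
    then show "v \<le> KD"
      using norm_cauchy_schwarz[of "D u" u] KD(2)[of u] by simp
  qed
  have D_unit: "inner (D u) u \<le> l" if "norm u = 1" for u
    unfolding l_def by (rule cSup_upper[OF _ bdd]) (use that in \<open>auto simp: V_def\<close>)
  have D_le: "inner (D y) y \<le> l * (norm y)\<^sup>2" for y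
  proof (cases "y = 0")
    case False
    then have "inner (D ((1 / norm y) *\<^sub>R y)) ((1 / norm y) *\<^sub>R y) \<le> l"
      by (intro D_unit) simp
    then show ?thesis
      using False by (simp add: D.scaleR field_simps power2_eq_square)
  qed (simp add: D.zero)
  have "0 < inner (D x) x"
    using not_le by (simp add: D_def inner_diff_left)
  then have l: "0 < l"
    using D_le[of x] by (smt (verit) mult_nonpos_nonneg zero_le_power2)
  define P where "P y = l *\<^sub>R y - D y" for y
  interpret P: real_positive P
  proof
    show "P (a + b) = P a + P b" for a b
      by (simp add: P_def D.add algebra_simps)
    show "P (r *\<^sub>R a) = r *\<^sub>R P a" for r a
      by (simp add: P_def D.scaleR algebra_simps)
    show "inner (P a) b = inner a (P b)" for a b
      by (simp add: P_def D_def algebra_simps inner_diff_left inner_diff_right A_sym Q_sym)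
    show "0 \<le> inner (P a) a" for a
      using D_le[of a] by (simp add: P_def inner_diff_left power2_norm_eq_inner)
  qed
  define K where "K = l + KD"
  have K: "0 < K" "\<And>y. norm (P y) \<le> K * norm y"
  proof -
    show "0 < K" using l KD by (simp add: K_def)
    show "norm (P y) \<le> K * norm y" for y
      using norm_triangle_ineq4[of "l *\<^sub>R y" "D y"] KD(2)[of y] l
      by (simp add: P_def K_def algebra_simps)
  qed
  define G where "G = c * KA + l"
  have G: "0 < G"
    using c KA l by (simp add: G_def add_nonneg_pos)
  \<comment> \<open>With \<open>\<parallel>P u\<parallel> < \<eta>\<close> the cross term \<open>2 * inner w (P u)\<close> below is at most \<open>l\<^sup>2 / 2\<close>.\<close>
  define \<eta> where "\<eta> = l\<^sup>2 / (4 * G)"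
  have \<eta>: "0 < \<eta>"
    using l G by (simp add: \<eta>_def)
  have "V \<noteq> {}"
  proof -
    have "x \<noteq> 0"
      using \<open>0 < inner (D x) x\<close> by auto
    then have "norm ((1 / norm x) *\<^sub>R x) = 1" by simp
    then show ?thesis unfolding V_def by blast
  qed
  moreover have "l - \<eta>\<^sup>2 / K < Sup V"
    using \<eta> K by (simp add: l_def)
  ultimately obtain u where u: "norm u = 1" "l - \<eta>\<^sup>2 / K < inner (D u) u"
    unfolding less_cSup_iff[OF \<open>V \<noteq> {}\<close> bdd] by (auto simp: V_def)
  have "(norm (P u))\<^sup>2 \<le> K * inner (P u) u"
    using K by (intro P.norm_sq_le) auto
  also have "inner (P u) u < \<eta>\<^sup>2 / K"
    using u by (simp add: P_def inner_diff_left power2_norm_eq_inner[symmetric])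
  then have "K * inner (P u) u < \<eta>\<^sup>2"
    using K by (simp add: field_simps)
  finally have Pu: "norm (P u) < \<eta>"
    by (rule power2_less_imp_less) (use \<eta> in simp)
  define w where "w = c *\<^sub>R A u + l *\<^sub>R u"
  have Qu: "Q u = w - P u"
    by (simp add: w_def P_def D_def)
  have "norm w \<le> G"
  proof -
    have "norm w \<le> c * norm (A u) + l * norm u"
      unfolding w_def using norm_triangle_ineq[of "c *\<^sub>R A u" "l *\<^sub>R u"] c l by simp
    also have "c * norm (A u) \<le> c * KA"
      using KA(2)[of u] u c by (simp add: mult_left_mono)
    finally show ?thesis
      using u by (simp add: G_def)
  qed
  then have "norm w * norm (P u) \<le> G * \<eta>"
    using Pu G by (intro mult_mono) auto
  then have "2 * inner w (P u) \<le> 2 * (G * \<eta>)"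
    using norm_cauchy_schwarz[of w "P u"] by linarith
  also have "\<dots> < l\<^sup>2"
    using G l by (simp add: \<eta>_def)
  finally have small: "2 * inner w (P u) < l\<^sup>2" .
  have "(norm w)\<^sup>2 = (c * norm (A u))\<^sup>2 + 2 * c * l * inner (A u) u + l\<^sup>2"
    using u unfolding w_def power_mult_distrib power2_norm_eq_inner norm_eq_1
    by (simp add: inner_add_left inner_add_right inner_commute power2_eq_square algebra_simps)
  then have "(c * norm (A u))\<^sup>2 + l\<^sup>2 \<le> (norm w)\<^sup>2"
    using c l A_nonneg[of u] by simp
  moreover have "(norm (Q u))\<^sup>2 \<le> (c * norm (A u))\<^sup>2"
    using dom[of u] by (intro power_mono) auto
  moreover have "(norm (Q u))\<^sup>2 = (norm w)\<^sup>2 - 2 * inner w (P u) + (norm (P u))\<^sup>2"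
    unfolding Qu by (simp add: power2_norm_eq_inner inner_diff_left inner_diff_right inner_commute)
  ultimately show False
    using small by (smt (verit) zero_le_power2)
qed

section \<open>Complex adjoints\<close>

lemma cinner_add_right: "cinner x (y + z) = cinner x y + cinner x z"
  by (metis cinner_add_left cinner_commute complex_cnj_add)

lemma cinner_scaleC_right: "cinner x (c *\<^sub>C y) = cnj c * cinner x y"
  by (metis cinner_scaleC_left cinner_commute complex_cnj_mult)

lemma cinner_zero_left: "cinner 0 y = 0"
  by (metis add_cancel_right_right cinner_add_left)

lemma Im_cinner: "Im (cinner x y) = - inner (\<i> *\<^sub>C x) y"
  by (simp add: inner_eq_Re_cinner cinner_scaleC_left)

lemma bounded_clinear_imp_bounded_linear: "bounded_clinear T \<Longrightarrow> bounded_linear T"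
  by (simp add: bounded_clinear_def)

lemma bounded_clinear_scaleC: "bounded_clinear T \<Longrightarrow> T (c *\<^sub>C x) = c *\<^sub>C T x"
  by (simp add: bounded_clinear_def)

text \<open>
  Riesz representation turns the description of \<open>cadjoint T\<close> into the defining identity. The real
  theorem yields the real part; the imaginary part is the real part at \<open>\<i> x\<close>.
\<close>
theorem cinner_cadjoint:
  fixes T :: "'a::complex_hilbert \<Rightarrow> 'a"
  assumes T: "bounded_clinear T"
  shows "cinner (T x) y = cinner x (cadjoint T y)"
proof -
  have "\<exists>s. \<forall>x. cinner (T x) y = cinner x s" for y
  proof -
    have "bounded_linear (\<lambda>x. inner (T x) y)"
      using bounded_linear_compose[OF bounded_linear_inner_left
          bounded_clinear_imp_bounded_linear[OF T]] .
    then obtain s where s: "\<And>x. inner (T x) y = inner x s"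
      using riesz_representation by blast
    have "cinner (T x) y = cinner x s" for x
    proof (rule complex_eqI)
      show "Re (cinner (T x) y) = Re (cinner x s)"
        using s by (simp flip: inner_eq_Re_cinner)
      show "Im (cinner (T x) y) = Im (cinner x s)"
        unfolding Im_cinner using s[of "\<i> *\<^sub>C x"] by (simp add: bounded_clinear_scaleC[OF T])
    qed
    then show ?thesis by blast
  qed
  then obtain S where S: "\<And>x y. cinner (T x) y = cinner x (S y)"
    by metis
  then have "cadjoint T = S"
    by (rule cadjoint_eqI)
  with S show ?thesis by simp
qed

text \<open>
  The function \<open>X\<close> is any solution of \<open>A X = T\<^sup>* A\<close>. Where \<open>A\<close> has a kernel it is far from unique and
  need be neither linear nor bounded.
\<close>
definition A_adjoint :: "('a::complex_hilbert \<Rightarrow> 'a) \<Rightarrow> ('a \<Rightarrow> 'a) \<Rightarrow> ('a \<Rightarrow> 'a) \<Rightarrow> bool"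
  where "A_adjoint A T X \<longleftrightarrow> (\<forall>x y. A_inner A (T x) y = A_inner A x (X y))"

lemma obtain_unit_phase:
  obtains u where "cmod u = 1" and "u * z = complex_of_real (cmod z)"
proof (cases "z = 0")
  case True
  then show thesis using that[of 1] by simp
next
  case False
  have "cnj (sgn z) * z = complex_of_real (cmod z)"
    using False complex_norm_square[of z]
    by (simp add: sgn_div_norm scaleR_conv_of_real field_simps power2_eq_square)
  moreover have "cmod (cnj (sgn z)) = 1"
    using False by (simp add: norm_sgn)
  ultimately show thesis by (rule that[rotated])
qed

section \<open>The semi-inner product of a positive operator\<close>

locale positive_form =
  fixes A :: "'a::complex_hilbert \<Rightarrow> 'a"
  assumes clinear: "bounded_clinear A"
    and hermitian: "cinner (A x) y = cinner x (A y)"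
    and form_nonneg: "0 \<le> inner (A x) x"
begin

sublocale A: bounded_linear A
  by (rule bounded_clinear_imp_bounded_linear[OF clinear])

sublocale real_positive A
proof
  show "inner (A x) y = inner x (A y)" for x y
    using hermitian[of x y] by (simp only: inner_eq_Re_cinner)
qed (rule A.add A.scaleR form_nonneg)+

abbreviation semi :: "'a \<Rightarrow> real"  ("\<lparr>_\<rparr>")
  where "\<lparr>x\<rparr> \<equiv> A_norm A x"

lemma Re_A_inner: "Re (A_inner A x y) = inner (A x) y"
  by (simp add: A_inner_def inner_eq_Re_cinner)

lemma swap: "inner (A x) y = inner (A y) x"
  by (metis inner_commute sym)

lemma semi_sq: "\<lparr>x\<rparr>\<^sup>2 = inner (A x) x"
  by (simp add: A_norm_def Re_A_inner nonneg)

lemma semi_nonneg: "0 \<le> \<lparr>x\<rparr>"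
  by (simp add: A_norm_def Re_A_inner nonneg)

lemma semi_cauchy_schwarz: "inner (A x) y \<le> \<lparr>x\<rparr> * \<lparr>y\<rparr>"
proof -
  have "(inner (A x) y)\<^sup>2 \<le> (\<lparr>x\<rparr> * \<lparr>y\<rparr>)\<^sup>2"
    using cauchy_schwarz by (simp add: power_mult_distrib semi_sq)
  then show ?thesis
    by (rule power2_le_imp_le) (simp add: semi_nonneg)
qed

lemma semi_add_sq: "\<lparr>x + y\<rparr>\<^sup>2 = \<lparr>x\<rparr>\<^sup>2 + 2 * inner (A x) y + \<lparr>y\<rparr>\<^sup>2"
  by (simp add: semi_sq A.add inner_add_left inner_add_right swap[of y x])

lemma semi_triangle: "\<lparr>x + y\<rparr> \<le> \<lparr>x\<rparr> + \<lparr>y\<rparr>"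
proof -
  have "\<lparr>x + y\<rparr>\<^sup>2 \<le> (\<lparr>x\<rparr> + \<lparr>y\<rparr>)\<^sup>2"
    using semi_cauchy_schwarz[of x y] by (simp add: semi_add_sq power2_sum)
  then show ?thesis
    by (rule power2_le_imp_le) (simp add: semi_nonneg)
qed

lemma semi_minus: "\<lparr>- x\<rparr> = \<lparr>x\<rparr>"
  by (simp add: A_norm_def Re_A_inner A.neg)

lemma A_inner_add_left: "A_inner A (x + y) z = A_inner A x z + A_inner A y z"
  by (simp add: A_inner_def A.add cinner_add_left)

lemma A_inner_add_right: "A_inner A x (y + z) = A_inner A x y + A_inner A x z"
  by (simp add: A_inner_def cinner_add_right)

lemma A_inner_minus_left: "A_inner A (- x) y = - A_inner A x y"
  using A_inner_add_left[of x "- x" y]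
  by (simp add: A_inner_def A.zero cinner_zero_left eq_neg_iff_add_eq_0 add.commute)

lemma A_inner_minus_right: "A_inner A x (- y) = - A_inner A x y"
  using A_inner_minus_left[of y x] hermitian[of x "- y"] hermitian[of x y]
  by (metis A_inner_def cinner_commute complex_cnj_minus)

lemma A_inner_diff_left: "A_inner A (x - y) z = A_inner A x z - A_inner A y z"
  using A_inner_add_left[of "x - y" y z] by simp

lemma A_inner_scaleC_left: "A_inner A (c *\<^sub>C x) y = c * A_inner A x y"
  by (simp add: A_inner_def bounded_clinear_scaleC[OF clinear] cinner_scaleC_left)

lemma A_inner_scaleC_right: "A_inner A x (c *\<^sub>C y) = cnj c * A_inner A x y"
  by (simp add: A_inner_def cinner_scaleC_right)

lemma semi_scaleC: "\<lparr>c *\<^sub>C x\<rparr> = cmod c * \<lparr>x\<rparr>"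
proof -
  have "Re (c * (cnj c * z)) = (cmod c)\<^sup>2 * Re z" for z
    unfolding mult.assoc[symmetric] complex_norm_square[symmetric] by simp
  then show ?thesis
    by (simp add: A_norm_def A_inner_scaleC_left A_inner_scaleC_right real_sqrt_mult
        mult.left_commute[of "cnj c"] del: times_complex.sel)
qed

lemma A_inner_self: "A_inner A x x = complex_of_real (\<lparr>x\<rparr>\<^sup>2)"
proof (rule complex_eqI)
  have "Im (A_inner A x x) = - Im (A_inner A x x)"
    unfolding A_inner_def by (metis cinner_commute cnj.sel(2) hermitian)
  then show "Im (A_inner A x x) = Im (complex_of_real (\<lparr>x\<rparr>\<^sup>2))"
    by simp
qed (simp add: Re_A_inner semi_sq)

lemma cmod_A_inner_le: "cmod (A_inner A x y) \<le> \<lparr>x\<rparr> * \<lparr>y\<rparr>"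
proof -
  obtain u where u: "cmod u = 1" "u * A_inner A x y = complex_of_real (cmod (A_inner A x y))"
    by (rule obtain_unit_phase)
  have "cmod (A_inner A x y) = Re (u * A_inner A x y)"
    by (simp add: u)
  also have "\<dots> = inner (A (u *\<^sub>C x)) y"
    by (simp add: A_inner_scaleC_left flip: Re_A_inner)
  also have "\<dots> \<le> \<lparr>x\<rparr> * \<lparr>y\<rparr>"
    using semi_cauchy_schwarz[of "u *\<^sub>C x" y] u by (simp add: semi_scaleC)
  finally show ?thesis .
qed

section \<open>Operators bounded for the seminorm\<close>

text \<open>
  The family of all \<open>Q x\<close> with \<open>\<parallel>A x\<parallel> \<le> 1\<close>, where \<open>Q = A X T\<close>, is weakly bounded because
  \<open>inner (Q x) y = inner (A x) (X (T y))\<close>. Linearity of \<open>Q\<close> is read off from its form, since \<open>X\<close> is an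
  arbitrary function.
\<close>
theorem adjoint_imp_semi_bounded:
  assumes T: "bounded_linear T"
    and adj: "\<And>x y. inner (A (T x)) y = inner (A x) (X y)"
  obtains C where "0 \<le> C" and "\<And>x. \<lparr>T x\<rparr> \<le> C * \<lparr>x\<rparr>"
proof -
  interpret T: bounded_linear T by fact
  define Q where "Q x = A (X (T x))" for x
  have Q_form: "inner (Q x) y = inner (A (T x)) (T y)" for x y
    unfolding Q_def by (metis adj swap)
  have Q_weak: "inner (Q x) y = inner (A x) (X (T y))" for x y
    by (simp add: Q_form adj)
  have Q_sym: "inner (Q x) y = inner x (Q y)" for x y
    by (metis Q_form inner_commute swap)
  define F where "F = {Q x |x. norm (A x) \<le> 1}"
  have "\<exists>c. \<forall>v\<in>F. \<bar>inner v y\<bar> \<le> c" for y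
  proof (intro exI ballI)
    fix v assume "v \<in> F"
    then obtain x where x: "v = Q x" "norm (A x) \<le> 1"
      by (auto simp: F_def)
    have "\<bar>inner v y\<bar> \<le> norm (A x) * norm (X (T y))"
      unfolding x Q_weak by (rule Cauchy_Schwarz_ineq2)
    also have "\<dots> \<le> norm (X (T y))"
      using x by (simp add: mult_left_le_one_le)
    finally show "\<bar>inner v y\<bar> \<le> norm (X (T y))" .
  qed
  then obtain C0 where C0: "\<And>v. v \<in> F \<Longrightarrow> norm v \<le> C0"
    using weakly_bounded_imp_bounded by blast
  define C where "C = max C0 0"
  have Q_add: "Q (x + y) = Q x + Q y" for x y
    by (rule vector_eq_rdot[THEN iffD1])
      (simp add: Q_form T.add A.add inner_add_left)
  have Q_scale: "Q (r *\<^sub>R x) = r *\<^sub>R Q x" for r x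
    by (rule vector_eq_rdot[THEN iffD1])
      (simp add: Q_form T.scaleR A.scaleR)
  have dom: "norm (Q x) \<le> C * norm (A x)" for x
  proof (cases "A x = 0")
    case True
    then have "inner (Q x) (Q x) = 0"
      by (simp add: Q_weak)
    then show ?thesis by (simp add: True)
  next
    case False
    have "Q ((1 / norm (A x)) *\<^sub>R x) \<in> F"
      unfolding F_def using False by (auto simp: A.scaleR intro!: exI[of _ "(1 / norm (A x)) *\<^sub>R x"])
    then have "norm (Q ((1 / norm (A x)) *\<^sub>R x)) \<le> C"
      using C0 unfolding C_def by fastforce
    then show ?thesis
      using False by (simp add: Q_scale field_simps)
  qed
  obtain KA where KA: "\<And>y. norm (A y) \<le> norm y * KA"
    using A.bounded by blast
  have "bounded_linear Q"
  proof (rule bounded_linear_intro[where K = "C * KA"])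
    fix x
    have "norm (Q x) \<le> C * (norm x * KA)"
      using dom[of x] mult_left_mono[OF KA[of x], of C] by (simp add: C_def)
    then show "norm (Q x) \<le> norm x * (C * KA)"
      by (simp add: ac_simps)
  qed (simp_all add: Q_add Q_scale)
  then have "inner (Q x) x \<le> C * inner (A x) x" for x
    by (rule norm_domination_imp_form_domination[OF A.bounded_linear_axioms])
      (fact sym Q_sym nonneg dom | simp add: C_def)+
  then have "\<lparr>T x\<rparr>\<^sup>2 \<le> C * \<lparr>x\<rparr>\<^sup>2" for x
    by (simp add: Q_form semi_sq)
  then have "\<lparr>T x\<rparr> \<le> sqrt C * \<lparr>x\<rparr>" for x
    by (metis real_sqrt_le_mono real_sqrt_mult real_sqrt_unique semi_nonneg)
  moreover have "0 \<le> sqrt C"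
    by (simp add: C_def)
  ultimately show thesis
    using that by blast
qed

text \<open>
  The given bound \<open>C\<close> serves twice: it makes the defining supremum meaningful, and it controls \<open>T\<close> on
  the small remainder when \<open>x\<close> is approximated by a vector in the range of \<open>A\<close>.
\<close>
lemma semi_opnorm:
  assumes T: "linear T" and C: "0 \<le> C" "\<And>x. \<lparr>T x\<rparr> \<le> C * \<lparr>x\<rparr>"
  shows A_opnorm_nonneg: "0 \<le> A_opnorm A T"
    and semi_le_A_opnorm: "\<lparr>T x\<rparr> \<le> A_opnorm A T * \<lparr>x\<rparr>"
    and A_opnorm_le: "A_opnorm A T \<le> C"
proof -
  interpret T: linear T by fact
  define V where "V = insert 0 {\<lparr>T x\<rparr> / \<lparr>x\<rparr> |x. x \<in> closure (range A) \<and> x \<noteq> 0}"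
  have V_le: "v \<le> C" if "v \<in> V" for v
    using that C semi_nonneg
    by (auto simp: V_def divide_le_eq less_le)
  then have bdd: "bdd_above V"
    by (rule bdd_aboveI)
  have N: "A_opnorm A T = Sup V"
    by (simp add: A_opnorm_def V_def)
  show N_nonneg: "0 \<le> A_opnorm A T"
    unfolding N by (intro cSup_upper bdd) (simp add: V_def)
  show "A_opnorm A T \<le> C"
    unfolding N by (intro cSup_least V_le) (auto simp: V_def)
  have range_bound: "\<lparr>T (A z)\<rparr> \<le> A_opnorm A T * \<lparr>A z\<rparr>" for z
  proof (cases "\<lparr>A z\<rparr> = 0")
    case True
    then show ?thesis using C(2)[of "A z"] by simp
  next
    case False
    have "A z \<noteq> 0"
    proof
      assume "A z = 0"
      then have "\<lparr>A z\<rparr>\<^sup>2 = 0"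
        by (simp add: semi_sq)
      then show False using False by simp
    qed
    moreover have "A z \<in> closure (range A)"
      by (rule subsetD[OF closure_subset]) simp
    ultimately have "\<lparr>T (A z)\<rparr> / \<lparr>A z\<rparr> \<in> V"
      unfolding V_def by blast
    then have "\<lparr>T (A z)\<rparr> / \<lparr>A z\<rparr> \<le> A_opnorm A T"
      unfolding N by (intro cSup_upper bdd)
    then show ?thesis
      using False semi_nonneg[of "A z"] by (simp add: divide_le_eq)
  qed
  show "\<lparr>T x\<rparr> \<le> A_opnorm A T * \<lparr>x\<rparr>"
  proof (rule field_le_epsilon)
    fix e :: real assume e: "0 < e"
    define N where "N = A_opnorm A T"
    \<comment> \<open>An approximation of \<open>x\<close> up to \<open>d\<close> costs \<open>N * d\<close> at the approximant and \<open>C * d\<close> at the remainder.\<close>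
    define d where "d = e / (N + C + 1)"
    have pos: "0 < N + C + 1"
      using N_nonneg C by (simp add: N_def)
    then have d: "0 < d" "(N + C) * d \<le> e"
      using e N_nonneg C by (auto simp: d_def N_def field_simps)
    obtain z where "inner (A (x - A z)) (x - A z) < d\<^sup>2"
      using approximation_by_range[OF A.bounded_linear_axioms, of "d\<^sup>2" x] d by auto
    then have "\<lparr>x - A z\<rparr>\<^sup>2 < d\<^sup>2"
      by (simp add: semi_sq)
    then have r: "\<lparr>x - A z\<rparr> \<le> d"
      using power2_less_imp_less[of "\<lparr>x - A z\<rparr>" d] d by simp
    have "\<lparr>A z - x\<rparr> = \<lparr>x - A z\<rparr>"
      using semi_minus[of "x - A z"] by simp
    then have "\<lparr>A z\<rparr> \<le> \<lparr>x\<rparr> + d"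
      using semi_triangle[of x "A z - x"] r by simp
    then have "\<lparr>T (A z)\<rparr> \<le> N * (\<lparr>x\<rparr> + d)"
      using range_bound[of z] N_nonneg unfolding N_def by (meson mult_left_mono order_trans)
    moreover have "\<lparr>T (x - A z)\<rparr> \<le> C * d"
      using C(2)[of "x - A z"] r C(1) by (meson mult_left_mono order_trans)
    moreover have "\<lparr>T x\<rparr> \<le> \<lparr>T (A z)\<rparr> + \<lparr>T (x - A z)\<rparr>"
      using semi_triangle[of "T (A z)" "T (x - A z)"] by (simp add: T.diff)
    ultimately have "\<lparr>T x\<rparr> \<le> N * \<lparr>x\<rparr> + (N + C) * d"
      by (simp add: algebra_simps)
    then show "\<lparr>T x\<rparr> \<le> A_opnorm A T * \<lparr>x\<rparr> + e"
      using d unfolding N_def by linarith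
  qed
qed

lemma A_numrad_le:
  assumes "0 \<le> c" "\<And>x. cmod (A_inner A (T x) x) \<le> c * \<lparr>x\<rparr>\<^sup>2"
  shows "A_numrad A T \<le> c"
proof -
  have "cmod (A_inner A (T x) x) \<le> c" if "\<lparr>x\<rparr> = 1" for x
    using assms(2)[of x] that by simp
  then show ?thesis
    unfolding A_numrad_def using assms(1) by (intro cSup_least) auto
qed

text \<open>
  The bound on \<open>T\<close> makes the defining supremum meaningful. Vectors of seminorm zero cannot be
  normalised, but there the form vanishes by Cauchy--Schwarz.
\<close>
lemma numerical_radius:
  assumes T: "\<And>c x. T (c *\<^sub>C x) = c *\<^sub>C T x" and C: "\<And>x. \<lparr>T x\<rparr> \<le> C * \<lparr>x\<rparr>"
  shows A_numrad_nonneg: "0 \<le> A_numrad A T"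
    and cmod_A_inner_le_A_numrad: "cmod (A_inner A (T x) x) \<le> A_numrad A T * \<lparr>x\<rparr>\<^sup>2"
proof -
  define V where "V = insert 0 {cmod (A_inner A (T x) x) |x. \<lparr>x\<rparr> = 1}"
  have w: "A_numrad A T = Sup V"
    by (simp add: A_numrad_def V_def)
  have "v \<le> max 0 C" if "v \<in> V" for v
  proof -
    have "cmod (A_inner A (T x) x) \<le> C" if "\<lparr>x\<rparr> = 1" for x
      using cmod_A_inner_le[of "T x" x] C[of x] that by simp
    with that show ?thesis
      by (auto simp: V_def le_max_iff_disj)
  qed
  then have bdd: "bdd_above V"
    by (rule bdd_aboveI)
  show "0 \<le> A_numrad A T"
    unfolding w by (intro cSup_upper bdd) (simp add: V_def)
  show "cmod (A_inner A (T x) x) \<le> A_numrad A T * \<lparr>x\<rparr>\<^sup>2"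
  proof (cases "\<lparr>x\<rparr> = 0")
    case True
    then show ?thesis
      using cmod_A_inner_le[of "T x" x] by simp
  next
    case False
    define k where "k = complex_of_real (1 / \<lparr>x\<rparr>)"
    have k: "cmod k = 1 / \<lparr>x\<rparr>"
      using semi_nonneg by (simp add: k_def norm_divide)
    have "\<lparr>k *\<^sub>C x\<rparr> = 1"
      using False by (simp add: semi_scaleC k)
    then have "cmod (A_inner A (T (k *\<^sub>C x)) (k *\<^sub>C x)) \<le> A_numrad A T"
      unfolding w by (intro cSup_upper bdd) (auto simp: V_def)
    then show ?thesis
      using False semi_nonneg[of x]
      by (simp add: T A_inner_scaleC_left A_inner_scaleC_right norm_mult k field_simps
          power2_eq_square)
  qed
qed

section \<open>Kittaneh's inequality\<close>

text \<open>
  For \<open>A = 1\<close> the first estimate, \<open>s_le\<close>, is the inequality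
  \<open>\<parallel>T T\<^sup>* + T\<^sup>* T\<parallel> \<le> \<parallel>T\<parallel>\<^sup>2 + \<parallel>T\<^sup>2\<parallel>\<close>, obtained from the pair of vectors \<open>a = T\<^sup>* x\<close>, \<open>b = T x\<close>.
\<close>
lemma real_form_le:
  assumes adj: "\<And>x y. inner (A (T x)) y = inner (A x) (X y)"
    and N: "0 \<le> N" "\<And>x. \<lparr>T x\<rparr> \<le> N * \<lparr>x\<rparr>"
    and M: "0 \<le> M" "\<And>x. \<lparr>T (T x)\<rparr> \<le> M * \<lparr>x\<rparr>"
  shows "(2 * inner (A (T x)) x)\<^sup>2 \<le> (N\<^sup>2 + 3 * M) * (\<lparr>x\<rparr>\<^sup>2)\<^sup>2"
proof -
  have X_le: "\<lparr>X y\<rparr> \<le> N * \<lparr>y\<rparr>" for y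
  proof (cases "\<lparr>X y\<rparr> = 0")
    case True
    then show ?thesis using N semi_nonneg by simp
  next
    case False
    have "\<lparr>X y\<rparr> * \<lparr>X y\<rparr> = inner (A (T (X y))) y"
      using semi_sq[of "X y"] by (simp add: adj power2_eq_square)
    also have "\<dots> \<le> \<lparr>T (X y)\<rparr> * \<lparr>y\<rparr>"
      by (rule semi_cauchy_schwarz)
    also have "\<dots> \<le> (N * \<lparr>X y\<rparr>) * \<lparr>y\<rparr>"
      by (intro mult_right_mono N semi_nonneg)
    finally have "\<lparr>X y\<rparr> * \<lparr>X y\<rparr> \<le> \<lparr>X y\<rparr> * (N * \<lparr>y\<rparr>)"
      by (simp add: ac_simps)
    then show ?thesis
      using False semi_nonneg[of "X y"] by (simp add: mult_le_cancel_left)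
  qed
  have T2_le: "inner (A (T y)) (X z) \<le> M * \<lparr>y\<rparr> * \<lparr>z\<rparr>" for y z
  proof -
    have "inner (A (T y)) (X z) = inner (A (T (T y))) z"
      by (simp add: adj)
    also have "\<dots> \<le> \<lparr>T (T y)\<rparr> * \<lparr>z\<rparr>"
      by (rule semi_cauchy_schwarz)
    also have "\<dots> \<le> M * \<lparr>y\<rparr> * \<lparr>z\<rparr>"
      by (intro mult_right_mono M semi_nonneg)
    finally show ?thesis .
  qed
  define a b where "a = X x" and "b = T x"
  define s where "s = \<lparr>a\<rparr>\<^sup>2 + \<lparr>b\<rparr>\<^sup>2"
  have s_nonneg: "0 \<le> s"
    by (simp add: s_def)
  have s_le: "s \<le> (N\<^sup>2 + M) * \<lparr>x\<rparr>\<^sup>2"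
  proof (cases "s = 0")
    case True
    then show ?thesis using M by simp
  next
    case False
    have "s = inner (A (T a + X b)) x"
    proof -
      have "inner (A (T a)) x = \<lparr>a\<rparr>\<^sup>2"
        by (simp add: adj semi_sq a_def)
      moreover have "inner (A (X b)) x = \<lparr>b\<rparr>\<^sup>2"
        by (metis adj swap semi_sq b_def)
      ultimately show ?thesis
        by (simp add: s_def A.add inner_add_left)
    qed
    also have "\<dots> \<le> \<lparr>T a + X b\<rparr> * \<lparr>x\<rparr>"
      by (rule semi_cauchy_schwarz)
    finally have "s\<^sup>2 \<le> \<lparr>T a + X b\<rparr>\<^sup>2 * \<lparr>x\<rparr>\<^sup>2"
      using s_nonneg by (metis power_mono power_mult_distrib)
    also have "\<lparr>T a + X b\<rparr>\<^sup>2 \<le> (N\<^sup>2 + M) * s"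
    proof -
      have "\<lparr>T a\<rparr>\<^sup>2 \<le> N\<^sup>2 * \<lparr>a\<rparr>\<^sup>2" "\<lparr>X b\<rparr>\<^sup>2 \<le> N\<^sup>2 * \<lparr>b\<rparr>\<^sup>2"
        by (metis N(2) X_le power_mono power_mult_distrib semi_nonneg)+
      moreover have "2 * inner (A (T a)) (X b) \<le> M * (2 * \<lparr>a\<rparr> * \<lparr>b\<rparr>)"
        using T2_le[of a b] by simp
      moreover have "M * (2 * \<lparr>a\<rparr> * \<lparr>b\<rparr>) \<le> M * s"
        using sum_squares_bound M unfolding s_def by (intro mult_left_mono)
      ultimately show ?thesis
        unfolding semi_add_sq by (simp add: s_def algebra_simps)
    qed
    then have "\<lparr>T a + X b\<rparr>\<^sup>2 * \<lparr>x\<rparr>\<^sup>2 \<le> (N\<^sup>2 + M) * s * \<lparr>x\<rparr>\<^sup>2"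
      by (rule mult_right_mono) simp
    finally have "s * s \<le> s * ((N\<^sup>2 + M) * \<lparr>x\<rparr>\<^sup>2)"
      by (simp add: power2_eq_square ac_simps)
    then show ?thesis
      using False s_nonneg by (simp add: mult_le_cancel_left)
  qed
  have "(2 * inner (A (T x)) x)\<^sup>2 = (inner (A (b + a)) x)\<^sup>2"
    unfolding a_def b_def by (simp add: A.add inner_add_left swap[of "X x"] flip: adj)
  also have "\<dots> \<le> \<lparr>b + a\<rparr>\<^sup>2 * \<lparr>x\<rparr>\<^sup>2"
    using cauchy_schwarz by (simp add: semi_sq)
  also have "\<lparr>b + a\<rparr>\<^sup>2 \<le> (N\<^sup>2 + 3 * M) * \<lparr>x\<rparr>\<^sup>2"
    using s_le T2_le[of x x] unfolding semi_add_sq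
    by (simp add: s_def a_def b_def algebra_simps power2_eq_square)
  then have "\<lparr>b + a\<rparr>\<^sup>2 * \<lparr>x\<rparr>\<^sup>2 \<le> (N\<^sup>2 + 3 * M) * \<lparr>x\<rparr>\<^sup>2 * \<lparr>x\<rparr>\<^sup>2"
    by (rule mult_right_mono) simp
  finally show ?thesis
    by (simp add: power2_eq_square ac_simps)
qed

text \<open>
  The modulus of the form is its real part after rotating \<open>T\<close> by a unit scalar, which leaves the
  seminorms of \<open>T\<close> and \<open>T\<^sup>2\<close> unchanged.
\<close>
theorem numerical_range_le:
  assumes T: "\<And>c x. T (c *\<^sub>C x) = c *\<^sub>C T x" and adj: "A_adjoint A T X"
    and N: "0 \<le> N" "\<And>x. \<lparr>T x\<rparr> \<le> N * \<lparr>x\<rparr>"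
    and M: "0 \<le> M" "\<And>x. \<lparr>T (T x)\<rparr> \<le> M * \<lparr>x\<rparr>"
    and MN: "M \<le> N\<^sup>2"
  shows "cmod (A_inner A (T x) x) \<le> 1 / 2 * (N + sqrt M) * \<lparr>x\<rparr>\<^sup>2"
proof -
  obtain u where u: "cmod u = 1"
      "u * A_inner A (T x) x = complex_of_real (cmod (A_inner A (T x) x))"
    by (rule obtain_unit_phase)
  have rot_adj: "inner (A (u *\<^sub>C T y)) z = inner (A y) (X (cnj u *\<^sub>C z))" for y z
  proof -
    have "A_inner A (u *\<^sub>C T y) z = A_inner A (T y) (cnj u *\<^sub>C z)"
      by (simp add: A_inner_scaleC_left A_inner_scaleC_right)
    also have "\<dots> = A_inner A y (X (cnj u *\<^sub>C z))"
      using adj by (simp add: A_adjoint_def)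
    finally show ?thesis
      by (simp flip: Re_A_inner)
  qed
  have "cmod (A_inner A (T x) x) = inner (A (u *\<^sub>C T x)) x"
    using u by (simp add: A_inner_scaleC_left flip: Re_A_inner)
  then have "(2 * cmod (A_inner A (T x) x))\<^sup>2 \<le> (N\<^sup>2 + 3 * M) * (\<lparr>x\<rparr>\<^sup>2)\<^sup>2"
    using real_form_le[of "\<lambda>y. u *\<^sub>C T y" "\<lambda>z. X (cnj u *\<^sub>C z)" N M x] rot_adj N M u
    by (simp add: T semi_scaleC)
  also have "N\<^sup>2 + 3 * M \<le> (N + sqrt M)\<^sup>2"
  proof -
    have "sqrt M \<le> N"
      using MN N by (simp add: real_le_lsqrt)
    then have "sqrt M * sqrt M \<le> N * sqrt M"
      using M by (intro mult_right_mono) auto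
    then show ?thesis
      using M by (simp add: power2_sum)
  qed
  then have "(N\<^sup>2 + 3 * M) * (\<lparr>x\<rparr>\<^sup>2)\<^sup>2 \<le> ((N + sqrt M) * \<lparr>x\<rparr>\<^sup>2)\<^sup>2"
    unfolding power_mult_distrib by (rule mult_right_mono) simp
  finally have "2 * cmod (A_inner A (T x) x) \<le> (N + sqrt M) * \<lparr>x\<rparr>\<^sup>2"
    by (rule power2_le_imp_le) (use N M in simp)
  then show ?thesis by simp
qed

theorem kittaneh_inequality:
  assumes T: "bounded_clinear T" and adj: "A_adjoint A T X"
  defines "b \<equiv> 1 / 2 * (A_opnorm A T + sqrt (A_opnorm A (T \<circ> T)))"
  shows opnorm_mean_nonneg: "0 \<le> b"
    and numerical_range_le_opnorm: "cmod (A_inner A (T x) x) \<le> b * \<lparr>x\<rparr>\<^sup>2"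
proof -
  have lin: "bounded_linear T"
    by (rule bounded_clinear_imp_bounded_linear[OF T])
  have real_adj: "inner (A (T x)) y = inner (A x) (X y)" for x y
    using adj by (simp add: A_adjoint_def flip: Re_A_inner)
  obtain C where C: "0 \<le> C" "\<And>x. \<lparr>T x\<rparr> \<le> C * \<lparr>x\<rparr>"
    using adjoint_imp_semi_bounded[OF lin real_adj] by blast
  have linear_T: "linear T"
    by (rule bounded_linear.linear[OF lin])
  note N = A_opnorm_nonneg[OF linear_T C] semi_le_A_opnorm[OF linear_T C]
  have linear_TT: "linear (T \<circ> T)"
    by (rule linear_compose[OF linear_T linear_T])
  have TT: "\<lparr>(T \<circ> T) y\<rparr> \<le> (A_opnorm A T)\<^sup>2 * \<lparr>y\<rparr>" for y
    using N(2)[of "T y"] mult_left_mono[OF N(2)[of y] N(1)]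
    by (simp add: power2_eq_square mult.assoc)
  note M = A_opnorm_nonneg[OF linear_TT zero_le_power2 TT] semi_le_A_opnorm[OF linear_TT zero_le_power2 TT]
    A_opnorm_le[OF linear_TT zero_le_power2 TT]
  show "0 \<le> b"
    using N(1) M(1) by (simp add: b_def comp_def)
  show "cmod (A_inner A (T x) x) \<le> b * \<lparr>x\<rparr>\<^sup>2"
    unfolding b_def
    by (rule numerical_range_le[OF bounded_clinear_scaleC[OF T] adj N M(1) _ M(3)])
      (use M(2) in \<open>simp add: comp_def\<close>)
qed

section \<open>The form of an off-diagonal matrix\<close>

text \<open>
  The hypothesis bounds the quadratic form of the off-diagonal matrix with entries \<open>R\<close> and \<open>S\<close> at
  \<open>(x, y)\<close>. It is used at \<open>y = t v S x\<close>, where \<open>v\<^sup>2\<close> rotates \<open>\<langle>R S x, x\<rangle>\<close> onto the nonnegative axis: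
  multiplied by \<open>v\<close>, the form becomes \<open>t (\<bar>\<langle>R S x, x\<rangle>\<bar> + \<lparr>S x\<rparr>\<^sup>2)\<close>.
\<close>
lemma product_form_le:
  assumes hom: "\<And>c x. R (c *\<^sub>C x) = c *\<^sub>C R x" and c: "0 \<le> c"
    and form: "\<And>x y. cmod (A_inner A (R y) x + A_inner A (S x) y) \<le> c * (\<lparr>x\<rparr>\<^sup>2 + \<lparr>y\<rparr>\<^sup>2)"
  shows "cmod (A_inner A (R (S x)) x) \<le> c\<^sup>2 * \<lparr>x\<rparr>\<^sup>2"
proof -
  define a where "a = A_inner A (R (S x)) x"
  define b where "b = \<lparr>S x\<rparr>\<^sup>2"
  obtain u where u: "cmod u = 1" "u * a = complex_of_real (cmod a)"
    by (rule obtain_unit_phase)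
  define v where "v = csqrt u"
  have v: "cmod v = 1" "v * (v * a) = complex_of_real (cmod a)"
    using u power2_csqrt[of u] by (simp_all add: v_def power2_eq_square flip: mult.assoc)
  have vv: "v * cnj v = 1"
    using v(1) by (simp flip: complex_norm_square)
  have key: "t * (cmod a + b) \<le> c * (\<lparr>x\<rparr>\<^sup>2 + t\<^sup>2 * b)" if "0 < t" for t :: real
  proof -
    define y where "y = (complex_of_real t * v) *\<^sub>C S x"
    have "A_inner A (R y) x = of_real t * (v * a)"
      by (simp add: y_def hom A_inner_scaleC_left a_def)
    moreover have "A_inner A (S x) y = of_real t * (cnj v * of_real b)"
      by (simp add: y_def A_inner_scaleC_right A_inner_self b_def)
    ultimately have "v * (A_inner A (R y) x + A_inner A (S x) y)
        = of_real t * (v * (v * a)) + of_real t * (v * cnj v * of_real b)"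
      by (simp add: algebra_simps)
    also have "\<dots> = of_real (t * (cmod a + b))"
      unfolding v(2) vv by (simp add: algebra_simps)
    finally have "cmod (v * (A_inner A (R y) x + A_inner A (S x) y)) = cmod (of_real (t * (cmod a + b)))"
      by simp
    then have "cmod (A_inner A (R y) x + A_inner A (S x) y) = t * (cmod a + b)"
      using that v(1) by (simp add: norm_mult b_def del: of_real_mult of_real_add)
    moreover have "\<lparr>y\<rparr>\<^sup>2 = t\<^sup>2 * b"
      by (simp add: y_def semi_scaleC norm_mult v b_def power_mult_distrib)
    ultimately show ?thesis
      using form[of y x] by simp
  qed
  show ?thesis
  proof (cases "c = 0")
    case True
    then show ?thesis
      using key[of 1] by (simp add: a_def b_def) (smt (verit) norm_ge_zero zero_le_power2 norm_eq_zero)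
  next
    case False
    \<comment> \<open>At \<open>t = 1 / c\<close> the terms with \<open>b\<close> on the two sides of \<open>key\<close> agree.\<close>
    then have "c * (1 / c * (cmod a + b)) \<le> c * (c * (\<lparr>x\<rparr>\<^sup>2 + (1 / c)\<^sup>2 * b))"
      using c by (intro mult_left_mono key) auto
    then show ?thesis
      using False by (simp add: a_def power2_eq_square algebra_simps)
  qed
qed

end

section \<open>Operator matrices\<close>

lemma scaleC_zero_right: "c *\<^sub>C (0::'a::complex_inner) = 0"
  by (metis add_cancel_right_right scaleC_add_right)

lemma bounded_clinear_zero: "bounded_clinear (\<lambda>_. 0)"
  by (simp add: bounded_clinear_def scaleC_zero_right)

lemma bounded_clinear_block_op:
  assumes "bounded_clinear T1" "bounded_clinear T2" "bounded_clinear T3" "bounded_clinear T4"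
  shows "bounded_clinear (block_op T1 T2 T3 T4)"
proof -
  have comp: "bounded_linear (\<lambda>p. S (fst p))" "bounded_linear (\<lambda>p. S (snd p))"
    if "bounded_clinear S" for S :: "'a \<Rightarrow> 'a"
    using bounded_linear_compose[OF _ bounded_linear_fst] bounded_linear_compose[OF _ bounded_linear_snd]
      bounded_clinear_imp_bounded_linear[OF that] by blast+
  have "bounded_linear (\<lambda>p. (T1 (fst p) + T2 (snd p), T3 (fst p) + T4 (snd p)))"
    by (intro bounded_linear_Pair bounded_linear_add comp assms)
  moreover have "block_op T1 T2 T3 T4 = (\<lambda>p. (T1 (fst p) + T2 (snd p), T3 (fst p) + T4 (snd p)))"
    by (auto simp: block_op_def)
  ultimately have "bounded_linear (block_op T1 T2 T3 T4)"
    by simp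
  then show ?thesis
    using assms unfolding bounded_clinear_def
    by (auto simp: block_op_def scaleC_prod_def scaleC_add_right)
qed

lemma A_inner_diag_op:
  "A_inner (diag_op A) (x, y) (x', y') = A_inner A x x' + A_inner A y y'"
  by (simp add: A_inner_def diag_op_def block_op_def cinner_prod_def)

context positive_form
begin

lemma positive_form_diag_op: "positive_form (diag_op A)"
proof
  show "bounded_clinear (diag_op A)"
    unfolding diag_op_def by (intro bounded_clinear_block_op clinear bounded_clinear_zero)
  show "cinner (diag_op A p) q = cinner p (diag_op A q)" for p q
    by (cases p; cases q) (simp add: diag_op_def block_op_def cinner_prod_def hermitian)
  show "0 \<le> inner (diag_op A p) p" for p
    by (cases p) (simp add: diag_op_def block_op_def form_nonneg)
qed

lemma semi_diag_op_sq: "(A_norm (diag_op A) (x, y))\<^sup>2 = \<lparr>x\<rparr>\<^sup>2 + \<lparr>y\<rparr>\<^sup>2"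
  unfolding positive_form.semi_sq[OF positive_form_diag_op] semi_sq
  by (simp add: diag_op_def block_op_def)

lemma A_adjoint_block_op:
  assumes "A_adjoint A T1 X1" "A_adjoint A T2 X2" "A_adjoint A T3 X3" "A_adjoint A T4 X4"
  shows "A_adjoint (diag_op A) (block_op T1 T2 T3 T4) (block_op X1 X3 X2 X4)"
  using assms
  by (auto simp: A_adjoint_def block_op_def A_inner_diag_op A_inner_add_left A_inner_add_right)

lemma A_adjoint_zero: "A_adjoint A (\<lambda>_. 0) (\<lambda>_. 0)"
  by (simp add: A_adjoint_def A_inner_def A.zero cinner_zero_left)
    (metis cinner_zero_left cinner_commute complex_cnj_zero)

lemma A_adjointableE:
  assumes "T \<in> A_adjointable A"
  obtains X where "bounded_clinear T" and "A_adjoint A T X"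
proof -
  have T: "bounded_clinear T" and range: "range (cadjoint T \<circ> A) \<subseteq> range A"
    using assms by (auto simp: A_adjointable_def)
  have "\<exists>z. cadjoint T (A y) = A z" for y
    using range by (auto simp: image_iff subset_iff)
  then obtain X where X: "\<And>y. cadjoint T (A y) = A (X y)"
    by metis
  have "A_adjoint A T X"
    unfolding A_adjoint_def A_inner_def by (simp add: hermitian cinner_cadjoint[OF T] X)
  with T show thesis by (rule that)
qed

lemma A_numrad_off_diagonal:
  assumes T2: "T2 \<in> A_adjointable A" and T3: "T3 \<in> A_adjointable A"
  defines "w \<equiv> A_numrad (diag_op A) (block_op (\<lambda>_. 0) T2 T3 (\<lambda>_. 0))"
  shows A_numrad_off_diagonal_nonneg: "0 \<le> w"
    and off_diagonal_form_le:
      "cmod (A_inner A (T2 y) x + A_inner A (T3 x) y) \<le> w * (\<lparr>x\<rparr>\<^sup>2 + \<lparr>y\<rparr>\<^sup>2)"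
proof -
  interpret D: positive_form "diag_op A"
    by (rule positive_form_diag_op)
  obtain X2 where X2: "bounded_clinear T2" "A_adjoint A T2 X2"
    using T2 by (rule A_adjointableE)
  obtain X3 where X3: "bounded_clinear T3" "A_adjoint A T3 X3"
    using T3 by (rule A_adjointableE)
  define S where "S = block_op (\<lambda>_. 0) T2 T3 (\<lambda>_. 0)"
  have S: "bounded_clinear S"
    unfolding S_def by (intro bounded_clinear_block_op bounded_clinear_zero X2 X3)
  have "A_adjoint (diag_op A) S (block_op (\<lambda>_. 0) X3 X2 (\<lambda>_. 0))"
    unfolding S_def by (intro A_adjoint_block_op A_adjoint_zero X2 X3)
  then have adj: "inner (diag_op A (S p)) q = inner (diag_op A p) (block_op (\<lambda>_. 0) X3 X2 (\<lambda>_. 0) q)"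
    for p q
    unfolding A_adjoint_def by (metis D.Re_A_inner)
  obtain C where "\<And>p. A_norm (diag_op A) (S p) \<le> C * A_norm (diag_op A) p"
    using D.adjoint_imp_semi_bounded[OF bounded_clinear_imp_bounded_linear[OF S] adj] by blast
  note w = D.numerical_radius[OF bounded_clinear_scaleC[OF S] this]
  show "0 \<le> w"
    using w(1) by (simp add: w_def S_def)
  show "cmod (A_inner A (T2 y) x + A_inner A (T3 x) y) \<le> w * (\<lparr>x\<rparr>\<^sup>2 + \<lparr>y\<rparr>\<^sup>2)"
    using w(2)[of "(x, y)"]
    by (simp add: w_def S_def block_op_def A_inner_diag_op semi_diag_op_sq)
qed

end

lemma positive_op_imp_positive_form:
  assumes "positive_op A"
  shows "positive_form A"
proof
  show A: "bounded_clinear A"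
    using assms by (simp add: positive_op_def)
  show "cinner (A x) y = cinner x (A y)" for x y
    using cinner_cadjoint[OF A] assms by (simp add: positive_op_def)
  show "0 \<le> inner (A x) x" for x
    using assms by (simp add: positive_op_def inner_eq_Re_cinner complex_nonneg_Reals_iff)
qed

theorem theorem3p6:
  fixes A T1 T2 T3 T4 :: "'a::complex_hilbert \<Rightarrow> 'a"
    and T :: "'a \<times> 'a \<Rightarrow> 'a \<times> 'a"
  assumes "positive_op A"
    and "T1 \<in> A_adjointable A" and "T2 \<in> A_adjointable A"
    and "T3 \<in> A_adjointable A" and "T4 \<in> A_adjointable A"
    and "T = block_op T1 T2 T3 T4"
  shows "max (sqrt (A_numrad A (T2 \<circ> T3))) (sqrt (A_numrad A (T3 \<circ> T2)))
           \<le> A_numrad (diag_op A) (block_op (\<lambda>_. 0) T2 T3 (\<lambda>_. 0))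
       \<and> A_numrad (diag_op A) (block_op (\<lambda>_. 0) T2 T3 (\<lambda>_. 0))
           \<le> 1 / 2 * (A_opnorm (diag_op A) T + sqrt (A_opnorm (diag_op A) (T \<circ> T)))"
proof -
  interpret positive_form A
    by (rule positive_op_imp_positive_form) fact
  interpret D: positive_form "diag_op A"
    by (rule positive_form_diag_op)
  define w where "w = A_numrad (diag_op A) (block_op (\<lambda>_. 0) T2 T3 (\<lambda>_. 0))"
  define b where "b = 1 / 2 * (A_opnorm (diag_op A) T + sqrt (A_opnorm (diag_op A) (T \<circ> T)))"
  obtain X1 where X1: "bounded_clinear T1" "A_adjoint A T1 X1"
    using assms(2) by (rule A_adjointableE)
  obtain X2 where X2: "bounded_clinear T2" "A_adjoint A T2 X2"
    using assms(3) by (rule A_adjointableE)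
  obtain X3 where X3: "bounded_clinear T3" "A_adjoint A T3 X3"
    using assms(4) by (rule A_adjointableE)
  obtain X4 where X4: "bounded_clinear T4" "A_adjoint A T4 X4"
    using assms(5) by (rule A_adjointableE)

  have w_nonneg: "0 \<le> w"
    unfolding w_def by (rule A_numrad_off_diagonal_nonneg[OF assms(3,4)])
  have off_form: "cmod (A_inner A (T2 y) x + A_inner A (T3 x) y) \<le> w * (\<lparr>x\<rparr>\<^sup>2 + \<lparr>y\<rparr>\<^sup>2)" for x y
    unfolding w_def by (rule off_diagonal_form_le[OF assms(3,4)])
  have "A_numrad A (T2 \<circ> T3) \<le> w\<^sup>2"
    using product_form_le[OF bounded_clinear_scaleC[OF X2(1)] w_nonneg off_form]
    by (intro A_numrad_le) auto
  moreover have "A_numrad A (T3 \<circ> T2) \<le> w\<^sup>2"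
  proof -
    have "cmod (A_inner A (T3 y) x + A_inner A (T2 x) y) \<le> w * (\<lparr>x\<rparr>\<^sup>2 + \<lparr>y\<rparr>\<^sup>2)" for x y
      using off_form[of x y] by (simp add: add.commute)
    then show ?thesis
      using product_form_le[OF bounded_clinear_scaleC[OF X3(1)] w_nonneg]
      by (intro A_numrad_le) auto
  qed
  ultimately have lower: "max (sqrt (A_numrad A (T2 \<circ> T3))) (sqrt (A_numrad A (T3 \<circ> T2))) \<le> w"
    using w_nonneg by (simp add: real_le_lsqrt)

  have T: "bounded_clinear T" "A_adjoint (diag_op A) T (block_op X1 X3 X2 X4)"
    unfolding \<open>T = _\<close>
    by (intro bounded_clinear_block_op A_adjoint_block_op X1 X2 X3 X4)+
  define q where "q x y = A_inner (diag_op A) (T (x, y)) (x, y)" for x y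
  have q_le: "cmod (q x y) \<le> b * (\<lparr>x\<rparr>\<^sup>2 + \<lparr>y\<rparr>\<^sup>2)" for x y
    using D.numerical_range_le_opnorm[OF T, of "(x, y)"] by (simp add: b_def q_def semi_diag_op_sq)
  have neg: "T2 (- y) = - T2 y" "T4 (- y) = - T4 y" for y
    using X2(1) X4(1) by (simp_all add: bounded_clinear_def bounded_linear.linear linear_neg)
  \<comment> \<open>Flipping the sign of the second component changes the sign of the off-diagonal form only.\<close>
  have pinch: "cmod (A_inner A (T2 y) x + A_inner A (T3 x) y) \<le> b * (\<lparr>x\<rparr>\<^sup>2 + \<lparr>y\<rparr>\<^sup>2)" for x y
  proof -
    have "2 * (A_inner A (T2 y) x + A_inner A (T3 x) y) = q x y - q x (- y)"
      by (simp add: q_def \<open>T = _\<close> block_op_def A_inner_diag_op neg A_inner_add_left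
          A_inner_diff_left A_inner_minus_right)
    then have "2 * cmod (A_inner A (T2 y) x + A_inner A (T3 x) y) \<le> cmod (q x y) + cmod (q x (- y))"
      by (metis norm_mult norm_numeral norm_triangle_ineq4)
    then show ?thesis
      using q_le[of x y] q_le[of x "- y"] by (simp add: semi_minus)
  qed
  have upper: "w \<le> b"
    unfolding w_def
  proof (rule D.A_numrad_le)
    show "0 \<le> b"
      unfolding b_def by (rule D.opnorm_mean_nonneg[OF T])
    show "cmod (A_inner (diag_op A) (block_op (\<lambda>_. 0) T2 T3 (\<lambda>_. 0) p) p)
        \<le> b * (A_norm (diag_op A) p)\<^sup>2" for p
      using pinch by (cases p) (simp add: block_op_def A_inner_diag_op semi_diag_op_sq)
  qed
  show ?thesis
    using lower upper unfolding w_def b_def by blast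
qed

end
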